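(* Consider the accelerated sticky particle dynamics with initial mass measure $P_0=\sum_{j=1}^N m_j\delta_{x_j}$, initial velocity function $u_0$ and initial acceleration function $\gamma_0$ (see context). Assume that $\gamma_0$ is non-increasing, i.e. $\gamma_0(x_1)\ge\gamma_0(x_2)\ge\cdots\ge\gamma_0(x_N)$. Let $t>0$ and let $\xi_t$ be the set of clusters at time $t$. For $\eta\in\{x_1,\dots,x_N\}$ put $\eta(t)=\eta+t\,u_0(\eta)+\frac{t^2}{2}\gamma_0(\eta)$. Then: 1. For every cluster $[\alpha,\beta]\in\xi_t$ and every $y\in(\alpha,\beta]$, $$\frac{\int_{[\alpha,y)}\eta(t)\,dP_0(\eta)}{P_0([\alpha,y))}\ \ge\ \frac{\int_{[y,\beta]}\eta(t)\,dP_0(\eta)}{P_0([y,\beta])}.$$ 2. A point $\alpha\in\{x_1,\dots,x_N\}$ is the left endpoint of an element of $\xi_t$ if and only if for all real $y_1<\alpha<y_2$ with $P_0([y_1,\alpha))>0$, $$\frac{\int_{[y_1,\alpha)}\eta(t)\,dP_0(\eta)}{P_0([y_1,\alpha))}\ <\ \frac{\int_{[\alpha,y_2)}\eta(t)\,dP_0(\eta)}{P_0([\alpha,y_2))}.$$ 3. A point $\beta\in\{x_1,\dots,x_N\}$ is the right endpoint of an element of $\xi_t$ if and only if for all real $y_1<\beta<y_2$ with $P_0((\beta,y_2])>0$, $$\frac{\int_{(y_1,\beta]}\eta(t)\,dP_0(\eta)}{P_0((y_1,\beta])}\ <\ \frac{\int_{(\beta,y_2]}\eta(t)\,dP_0(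\eta)}{P_0((\beta,y_2])}.$$
   Context: Accelerated sticky particle dynamics. There are $N$ particles with initial positions $x_1<\cdots<x_N$ in $\mathbb{R}$, masses $m_j>0$, initial velocities $v_j\in\mathbb{R}$ and initial accelerations $\theta_j\in\mathbb{R}$. Put $P_0=\sum_j m_j\delta_{x_j}$, $u_0(x_j)=v_j$, $\gamma_0(x_j)=\theta_j$. Each particle moves with constant acceleration until it collides; colliding particles stick together, with conservation of mass, momentum and force. Explicitly: for a nonempty set $G\subset\{x_1,\dots,x_N\}$ put $$c_G(t)=\frac{\sum_{x_j\in G}m_j\left(x_j+tv_j+\frac{t^2}{2}\theta_j\right)}{\sum_{x_j\in G}m_j}.$$ At time $0$ the partition $\xi_0$ of $\{x_1,\dots,x_N\}$ consists of the singletons. Let $s_0=0$. Given the partition $\xi_{s_k}$ at time $s_k$, the next shock time $s_{k+1}$ is the infimum of the times $t>s_k$ at which two distinct elements $G\ne G'$ of $\xi_{s_k}$ satisfy $c_G(t)=c_{G'}(t)$ ($s_{k+1}=+\infty$ if there is none). For $t\in[s_k,s_{k+1})$, $\xi_t=\xi_{s_k}$. At time $s_{k+1}$ all elements of $\xi_{s_k}$ having the same position $c_G(s_{k+1})$ are merged into one, which gives $\xi_{s_{k+1}}$. There are at most $N-1$ shock times. The elements of $\xi_t$ are called the clusters at time $t$; a cluster $G\in\xi_t$ is located at $c_G(t)$ at time $t$. Each cluster consists of consecutive initial positions and is written as an interval $[\alpha,\beta]$, meaning $[\alpha,\beta]\cap\{x_1,\dots,x_N\}$, where $\alpha$ is its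 smallest and $\beta$ its largest element (its left and right endpoints). *)

theory Defs
  imports "HOL-Analysis.Analysis"
begin

text \<open>
  The particles are indexed by \<open>{1..N}\<close>, with positions \<open>x j\<close> and masses \<open>m j\<close>. The initial
  velocity and acceleration are functions \<open>u0\<close>, \<open>\<gamma>0\<close> of the position; only their values at the
  points \<open>x j\<close> matter, where \<open>v_j = u0 (x j)\<close> and \<open>\<theta>_j = \<gamma>0 (x j)\<close>.
\<close>

definition particles :: "nat \<Rightarrow> (nat \<Rightarrow> real) \<Rightarrow> real set" where
  "particles N x = x ` {1..N}"

text \<open>
  The measure \<open>\<Sum>j. m j \<cdot> \<delta>(x j)\<close>, on the \<open>\<sigma>\<close>-algebra of all subsets of the real line rather than the
  Borel one: \<open>u0\<close> and \<open>\<gamma>0\<close> are arbitrary away from the particles, and the Bochner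
  integral of a non-measurable function is \<open>0\<close>.
\<close>

definition mass_measure :: "nat \<Rightarrow> (nat \<Rightarrow> real) \<Rightarrow> (nat \<Rightarrow> real) \<Rightarrow> real measure" where
  "mass_measure N x m =
     distr (point_measure {1..N} (\<lambda>j. ennreal (m j))) (count_space UNIV) x"

definition free_path :: "(real \<Rightarrow> real) \<Rightarrow> (real \<Rightarrow> real) \<Rightarrow> real \<Rightarrow> real \<Rightarrow> real" where
  "free_path u0 \<gamma>0 t \<eta> = \<eta> + t * u0 \<eta> + t\<^sup>2 / 2 * \<gamma>0 \<eta>"

definition cluster_pos ::
    "nat \<Rightarrow> (nat \<Rightarrow> real) \<Rightarrow> (nat \<Rightarrow> real) \<Rightarrow> (real \<Rightarrow> real) \<Rightarrow> (real \<Rightarrow> real)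
      \<Rightarrow> real set \<Rightarrow> real \<Rightarrow> real" where
  "cluster_pos N x m u0 \<gamma>0 G t =
     (\<Sum>j | j \<in> {1..N} \<and> x j \<in> G. m j * free_path u0 \<gamma>0 t (x j))
       / (\<Sum>j | j \<in> {1..N} \<and> x j \<in> G. m j)"

text \<open>In the extended reals the infimum of the empty set is \<open>\<infinity>\<close>.\<close>

definition next_shock ::
    "nat \<Rightarrow> (nat \<Rightarrow> real) \<Rightarrow> (nat \<Rightarrow> real) \<Rightarrow> (real \<Rightarrow> real) \<Rightarrow> (real \<Rightarrow> real)
      \<Rightarrow> ereal \<Rightarrow> real set set \<Rightarrow> ereal" where
  "next_shock N x m u0 \<gamma>0 s \<xi> =
     Inf {ereal t | t. s < ereal t \<and>
       (\<exists>G\<in>\<xi>. \<exists>G'\<in>\<xi>. G \<noteq> G' \<and> cluster_pos N x m u0 \<gamma>0 G t = cluster_pos N x m u0 \<gamma>0 G' t)}"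

definition merge_clusters ::
    "nat \<Rightarrow> (nat \<Rightarrow> real) \<Rightarrow> (nat \<Rightarrow> real) \<Rightarrow> (real \<Rightarrow> real) \<Rightarrow> (real \<Rightarrow> real)
      \<Rightarrow> real \<Rightarrow> real set set \<Rightarrow> real set set" where
  "merge_clusters N x m u0 \<gamma>0 t \<xi> =
     {\<Union> {G' \<in> \<xi>. cluster_pos N x m u0 \<gamma>0 G' t = cluster_pos N x m u0 \<gamma>0 G t} | G. G \<in> \<xi>}"

text \<open>
  The pair of the \<open>k\<close>-th shock time (with \<open>0\<close> as time number \<open>0\<close>) and the partition at that time.
  Once the time is \<open>\<infinity>\<close>, it and the partition stay constant.
\<close>

primrec shock_state ::
    "nat \<Rightarrow> (nat \<Rightarrow> real) \<Rightarrow> (nat \<Rightarrow> real) \<Rightarrow> (real \<Rightarrow> real) \<Rightarrow> (real \<Rightarrow> real)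
      \<Rightarrow> nat \<Rightarrow> ereal \<times> real set set" where
  "shock_state N x m u0 \<gamma>0 0 = (0, {{p} | p. p \<in> particles N x})"
| "shock_state N x m u0 \<gamma>0 (Suc k) =
     (let (s, \<xi>) = shock_state N x m u0 \<gamma>0 k;
          s' = next_shock N x m u0 \<gamma>0 s \<xi>
      in (s', if s' = \<infinity> then \<xi> else merge_clusters N x m u0 \<gamma>0 (real_of_ereal s') \<xi>))"

text \<open>
  The half-open intervals between consecutive shock times are disjoint and, the number of finite
  shock times being at most \<open>N - 1\<close>, cover all \<open>t \<ge> 0\<close>, so the index \<open>k\<close> exists and is unique.
\<close>

definition clusters ::
    "nat \<Rightarrow> (nat \<Rightarrow> real) \<Rightarrow> (nat \<Rightarrow> real) \<Rightarrow> (real \<Rightarrow> real) \<Rightarrow> (real \<Rightarrow> real)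
      \<Rightarrow> real \<Rightarrow> real set set" where
  "clusters N x m u0 \<gamma>0 t =
     snd (shock_state N x m u0 \<gamma>0
       (THE k. fst (shock_state N x m u0 \<gamma>0 k) \<le> ereal t \<and>
               ereal t < fst (shock_state N x m u0 \<gamma>0 (Suc k))))"

definition mean_over :: "real measure \<Rightarrow> (real \<Rightarrow> real) \<Rightarrow> real set \<Rightarrow> real" where
  "mean_over P f A = (LINT \<eta>:A|P. f \<eta>) / measure P A"

lemma emeasure_mass_measure:
  assumes "\<And>j. j \<in> {1..N} \<Longrightarrow> 0 \<le> m j"
  shows "emeasure (mass_measure N x m) A = ennreal (\<Sum>j=1..N. m j * indicator A (x j))"
proof -
  have "emeasure (mass_measure N x m) A = (\<Sum>j | j \<in> {1..N} \<and> x j \<in> A. ennreal (m j))"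
    unfolding mass_measure_def
    by (subst emeasure_distr)
      (auto simp: space_point_measure emeasure_point_measure_finite intro!: sum.cong)
  also have "\<dots> = (\<Sum>j=1..N. ennreal (m j * indicator A (x j)))"
    by (intro sum.mono_neutral_cong_left) (auto simp: indicator_def)
  also have "\<dots> = ennreal (\<Sum>j=1..N. m j * indicator A (x j))"
    using assms by (intro sum_ennreal) (auto simp: indicator_def)
  finally show ?thesis .
qed

lemma measure_mass_measure:
  assumes "\<And>j. j \<in> {1..N} \<Longrightarrow> 0 \<le> m j"
  shows "measure (mass_measure N x m) A = (\<Sum>j=1..N. m j * indicator A (x j))"
proof -
  have "0 \<le> (\<Sum>j=1..N. m j * indicator A (x j))"
    using assms by (intro sum_nonneg) (auto simp: indicator_def)
  then show ?thesis
    unfolding measure_def by (subst emeasure_mass_measure) (use assms in \<open>auto simp del: sum_mult_indicator\<close>)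
qed

lemma set_integral_mass_measure:
  assumes "\<And>j. j \<in> {1..N} \<Longrightarrow> 0 \<le> m j"
  shows "(LINT \<eta>:A|mass_measure N x m. f \<eta>) = (\<Sum>j=1..N. m j * indicator A (x j) * f (x j))"
proof -
  have "(LINT \<eta>:A|mass_measure N x m. f \<eta>) =
      (LINT j|point_measure {1..N} (\<lambda>j. ennreal (m j)). indicator A (x j) * f (x j))"
    unfolding mass_measure_def set_lebesgue_integral_def
    by (subst integral_distr) auto
  also have "\<dots> = (\<Sum>j=1..N. m j *\<^sub>R (indicator A (x j) * f (x j)))"
    using assms by (intro lebesgue_integral_point_measure_finite) auto
  finally show ?thesis
    by (simp add: mult.assoc)
qed

end

(*
  Cut a cluster G into a lower part A and the rest, and follow the quadratic polynomial
  q(t) = sum over A of m (free path - c_G(t)). As positions increase and accelerations decrease,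
  q(0) <= 0 and the leading coefficient is nonnegative; so once q(s) >= 0 for some s > 0, q stays
  nonnegative as long as G survives. When clusters merge, they have a common position, so the
  deviations of the lower parts of the merging clusters add up and q >= 0 holds at the shock. Hence
  at every time the lower part of a cluster has mean >= c_G and the upper part has mean <= c_G.
  Since the clusters are ordered intervals with strictly increasing positions, means over both
  sides of a boundary between clusters are strictly separated, and a cut through a cluster
  violates this strict separation.
*)

theory Submission
  imports Defs
begin

section \<open>Weighted averages and two elementary inequalities\<close>

definition wavg :: "('a \<Rightarrow> real) \<Rightarrow> ('a \<Rightarrow> real) \<Rightarrow> 'a set \<Rightarrow> real" where
  "wavg w f A = (\<Sum>a\<in>A. w a * f a) / (\<Sum>a\<in>A. w a)"

lemma sum_deviation:
  assumes "finite A" "A \<noteq> {}" "\<And>a. a \<in> A \<Longrightarrow> 0 < w a"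
  shows "(\<Sum>a\<in>A. w a * (f a - c)) = (wavg w f A - c) * (\<Sum>a\<in>A. w a)"
proof -
  have "0 < (\<Sum>a\<in>A. w a)" using assms by (intro sum_pos)
  then show ?thesis
    unfolding wavg_def by (simp add: field_simps sum_subtractf sum_distrib_left)
qed

text \<open>Multiplication by the positive total weight turns comparisons of averages into signs of
  sums of deviations, which, unlike averages, add up over disjoint sets.\<close>

lemma wavg_less_iff:
  assumes "finite A" "A \<noteq> {}" "\<And>a. a \<in> A \<Longrightarrow> 0 < w a"
  shows "wavg w f A < c \<longleftrightarrow> (\<Sum>a\<in>A. w a * (f a - c)) < 0"
    and "wavg w f A > c \<longleftrightarrow> (\<Sum>a\<in>A. w a * (f a - c)) > 0"
    and "wavg w f A = c \<longleftrightarrow> (\<Sum>a\<in>A. w a * (f a - c)) = 0"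
proof -
  have "0 < (\<Sum>a\<in>A. w a)" using assms by (intro sum_pos)
  then show "wavg w f A < c \<longleftrightarrow> (\<Sum>a\<in>A. w a * (f a - c)) < 0"
    and "wavg w f A > c \<longleftrightarrow> (\<Sum>a\<in>A. w a * (f a - c)) > 0"
    and "wavg w f A = c \<longleftrightarrow> (\<Sum>a\<in>A. w a * (f a - c)) = 0"
    by (auto simp: sum_deviation[OF assms] mult_less_0_iff zero_less_mult_iff)
qed

lemma wavg_le_iff:
  assumes "finite A" "A \<noteq> {}" "\<And>a. a \<in> A \<Longrightarrow> 0 < w a"
  shows "wavg w f A \<le> c \<longleftrightarrow> (\<Sum>a\<in>A. w a * (f a - c)) \<le> 0"
    and "wavg w f A \<ge> c \<longleftrightarrow> (\<Sum>a\<in>A. w a * (f a - c)) \<ge> 0"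
  using wavg_less_iff[OF assms, where f = f and c = c] by (auto simp flip: not_less)

text \<open>If no value on the lower part exceeds \<open>c\<close>, every summand is nonpositive.
  Otherwise monotonicity keeps all values above the cut at least \<open>c\<close>, so the upper part
  has a nonnegative sum, and the lower part balances it.\<close>

lemma sum_deviation_lower_part_le_0:
  fixes g :: "real \<Rightarrow> real"
  assumes "finite G" and w: "\<And>a. a \<in> G \<Longrightarrow> 0 \<le> w a"
    and mono: "mono_on G g" and D: "\<forall>a\<in>D. {..a} \<subseteq> D"
    and 0: "(\<Sum>a\<in>G. w a * (g a - c)) = 0"
  shows "(\<Sum>a\<in>G \<inter> D. w a * (g a - c)) \<le> 0"
proof (cases "\<forall>a\<in>G \<inter> D. g a \<le> c")
  case True
  then show ?thesis using w by (intro sum_nonpos) (auto intro!: mult_nonneg_nonpos)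
next
  case False
  then obtain a0 where a0: "a0 \<in> G" "a0 \<in> D" "c < g a0" by auto
  have "c \<le> g b" if "b \<in> G - D" for b
  proof -
    have "\<not> b \<le> a0" using a0 D that by auto
    then show ?thesis using mono_onD[OF mono, of a0 b] a0 that by simp
  qed
  then have "0 \<le> (\<Sum>a\<in>G - D. w a * (g a - c))"
    using w by (intro sum_nonneg) auto
  then show ?thesis using sum.Int_Diff[OF \<open>finite G\<close>, where g = "\<lambda>a. w a * (g a - c)" and B = D] 0 by simp
qed

text \<open>A convex function that starts at or below 0 and is nonnegative at \<open>s\<close>
  cannot become negative after \<open>s\<close>.\<close>

lemma convex_quadratic_nonneg:
  fixes a b c s t :: real
  assumes "a \<le> 0" "0 \<le> c" "0 < s" "s \<le> t" "0 \<le> a + s * b + s\<^sup>2 / 2 * c"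
  shows "0 \<le> a + t * b + t\<^sup>2 / 2 * c"
proof -
  \<comment> \<open>The convexity inequality for \<open>s\<close> between 0 and \<open>t\<close>,
    with its exact error term: the three summands come from the value at \<open>s\<close>, the value
    at 0 and the second derivative \<open>c\<close>.\<close>
  have "s * (a + t * b + t\<^sup>2 / 2 * c)
      = t * (a + s * b + s\<^sup>2 / 2 * c) + (t - s) * (- a) + s * t * (t - s) / 2 * c"
    by (simp add: field_simps power2_eq_square)
  also have "\<dots> \<ge> 0"
  proof (intro add_nonneg_nonneg[OF add_nonneg_nonneg])
    show "0 \<le> t * (a + s * b + s\<^sup>2 / 2 * c)" using assms by (intro mult_nonneg_nonneg) auto
    show "0 \<le> (t - s) * - a" using assms by (intro mult_nonneg_nonneg) auto
  qed (use assms in auto)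
  finally show ?thesis using assms by (simp add: zero_le_mult_iff)
qed

section \<open>Particles as weighted points of the real line\<close>

locale particle_system =
  fixes N :: nat and x m :: "nat \<Rightarrow> real" and u0 \<gamma>0 :: "real \<Rightarrow> real"
  assumes x_mono: "strict_mono_on {1..N} x"
    and mass_pos: "\<forall>j\<in>{1..N}. 0 < m j"
    and \<gamma>0_antimono: "antimono_on (particles N x) \<gamma>0"
begin

abbreviation "X \<equiv> particles N x"
abbreviation "flow \<equiv> free_path u0 \<gamma>0"
abbreviation "pos \<equiv> cluster_pos N x m u0 \<gamma>0"

text \<open>Masses are attached to positions rather than indices because clusters are sets of
  positions. The inverse of \<open>x\<close> is meaningful only on \<open>X\<close>; elsewhere the
  value is arbitrary.\<close>

definition w :: "real \<Rightarrow> real" where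
  "w \<eta> = m (inv_into {1..N} x \<eta>)"

lemma x_inj: "inj_on x {1..N}"
  using x_mono by (rule strict_mono_on_imp_inj_on)

lemma w_x: "j \<in> {1..N} \<Longrightarrow> w (x j) = m j"
  unfolding w_def using x_inj by simp

lemma w_pos: "\<eta> \<in> X \<Longrightarrow> 0 < w \<eta>"
  unfolding particles_def using mass_pos w_x by auto

lemma finite_X: "finite X"
  unfolding particles_def by simp

lemma card_X: "card X = N"
  unfolding particles_def using card_image[OF x_inj] by simp

lemma sum_particles:
  "(\<Sum>j | j \<in> {1..N} \<and> x j \<in> A. m j * f (x j)) = (\<Sum>\<eta>\<in>X \<inter> A. w \<eta> * f \<eta>)"
proof -
  have "X \<inter> A = x ` {j \<in> {1..N}. x j \<in> A}" unfolding particles_def by auto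
  moreover have "inj_on x {j \<in> {1..N}. x j \<in> A}" using x_inj by (rule inj_on_subset) auto
  ultimately show ?thesis by (simp add: sum.reindex w_x)
qed

lemma sum_particles_mass:
  "(\<Sum>j | j \<in> {1..N} \<and> x j \<in> A. m j) = (\<Sum>\<eta>\<in>X \<inter> A. w \<eta>)"
  using sum_particles[where f = "\<lambda>_. 1"] by simp

lemma pos_eq: "G \<subseteq> X \<Longrightarrow> pos G t = wavg w (flow t) G"
  unfolding cluster_pos_def wavg_def sum_particles sum_particles_mass
  by (simp add: Int_absorb1)

lemma sum_indicator_particles:
  "(\<Sum>j=1..N. m j * indicator A (x j) * f (x j)) = (\<Sum>\<eta>\<in>X \<inter> A. w \<eta> * f \<eta>)"
  unfolding sum_particles[symmetric]
  by (intro sum.mono_neutral_cong_right) (auto simp: indicator_def)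

lemma measure_eq: "measure (mass_measure N x m) A = (\<Sum>\<eta>\<in>X \<inter> A. w \<eta>)"
  using sum_indicator_particles[where f = "\<lambda>_. 1"] mass_pos
  by (subst measure_mass_measure) (auto simp: less_imp_le simp del: sum_mult_indicator)

lemma mean_over_eq: "mean_over (mass_measure N x m) f A = wavg w f (X \<inter> A)"
  unfolding mean_over_def wavg_def measure_eq sum_indicator_particles[symmetric] using mass_pos
  by (subst set_integral_mass_measure) (simp_all add: less_imp_le)

lemma measure_pos_iff: "measure (mass_measure N x m) A > 0 \<longleftrightarrow> X \<inter> A \<noteq> {}"
proof (cases "X \<inter> A = {}")
  case False
  then have "0 < (\<Sum>\<eta>\<in>X \<inter> A. w \<eta>)" using finite_X w_pos by (intro sum_pos) auto
  then show ?thesis using False measure_eq by simp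
qed (simp add: measure_eq)

text \<open>Averaging is linear in the averaged function, so a cluster moves along a quadratic
  polynomial with averaged initial data. This gives continuity in time and the coefficients for the
  convexity argument.\<close>

lemma pos_expand:
  assumes "G \<subseteq> X"
  shows "pos G t = wavg w (\<lambda>\<eta>. \<eta>) G + t * wavg w u0 G + t\<^sup>2 / 2 * wavg w \<gamma>0 G"
proof -
  have "(\<Sum>a\<in>G. w a * flow t a) =
      (\<Sum>a\<in>G. w a * a) + t * (\<Sum>a\<in>G. w a * u0 a) + t\<^sup>2 / 2 * (\<Sum>a\<in>G. w a * \<gamma>0 a)"
    unfolding free_path_def sum_distrib_left sum.distrib[symmetric]
    by (intro sum.cong) (auto simp: algebra_simps)
  then show ?thesis
    unfolding pos_eq[OF assms] wavg_def by (simp add: add_divide_distrib)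
qed

lemma continuous_pos: "G \<subseteq> X \<Longrightarrow> continuous_on A (pos G)"
  by (subst continuous_on_cong[OF refl pos_expand]) (auto intro!: continuous_intros)

lemma sum_deviation_cluster:
  assumes "G \<subseteq> X" "G \<noteq> {}"
  shows "(\<Sum>a\<in>G. w a * (f a - wavg w f G)) = 0"
  using wavg_less_iff(3)[of G w f] assms finite_X w_pos by (auto dest: finite_subset)

text \<open>The deviation of the lower part is a quadratic polynomial in time. Increasing positions
  make its constant term nonpositive, non-increasing accelerations make its leading coefficient
  nonnegative, and \<open>convex_quadratic_nonneg\<close> applies whatever the velocities
  are.\<close>

lemma lower_part_stays_ahead:
  assumes G: "G \<subseteq> X" "G \<noteq> {}" and D: "\<forall>a\<in>D. {..a} \<subseteq> D" and "0 < s" "s \<le> t"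
    and "0 \<le> (\<Sum>a\<in>G \<inter> D. w a * (flow s a - pos G s))"
  shows "0 \<le> (\<Sum>a\<in>G \<inter> D. w a * (flow t a - pos G t))"
proof -
  have fin: "finite G" and w: "\<And>a. a \<in> G \<Longrightarrow> 0 \<le> w a"
    using G finite_X w_pos by (auto dest: finite_subset intro: less_imp_le)
  define dev where "dev f = (\<Sum>a\<in>G \<inter> D. w a * (f a - wavg w f G))" for f :: "real \<Rightarrow> real"
  have expand: "(\<Sum>a\<in>G \<inter> D. w a * (flow t a - pos G t))
      = dev (\<lambda>\<eta>. \<eta>) + t * dev u0 + t\<^sup>2 / 2 * dev \<gamma>0" for t
    unfolding dev_def sum_distrib_left sum.distrib[symmetric] pos_expand[OF G(1)] free_path_def
    by (intro sum.cong) (auto simp: algebra_simps)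
  have "dev (\<lambda>\<eta>. \<eta>) \<le> 0"
    unfolding dev_def by (rule sum_deviation_lower_part_le_0[OF fin w _ D])
      (use sum_deviation_cluster[OF G] in \<open>auto intro: mono_onI\<close>)
  \<comment> \<open>The negated acceleration is non-decreasing, so the lemma used for positions also
    yields the opposite sign for \<open>dev \<gamma>0\<close>.\<close>
  moreover have "(\<Sum>a\<in>G \<inter> D. w a * (- \<gamma>0 a - (- wavg w \<gamma>0 G))) \<le> 0"
  proof (rule sum_deviation_lower_part_le_0[OF fin w _ D])
    show "mono_on G (\<lambda>a. - \<gamma>0 a)"
      using \<gamma>0_antimono G(1) unfolding monotone_on_def by auto
    have "(\<Sum>a\<in>G. w a * (- \<gamma>0 a - (- wavg w \<gamma>0 G))) = - (\<Sum>a\<in>G. w a * (\<gamma>0 a - wavg w \<gamma>0 G))"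
      unfolding sum_negf[symmetric] by (intro sum.cong) (auto simp: algebra_simps)
    then show "(\<Sum>a\<in>G. w a * (- \<gamma>0 a - (- wavg w \<gamma>0 G))) = 0"
      using sum_deviation_cluster[OF G] by simp
  qed
  moreover have "(\<Sum>a\<in>G \<inter> D. w a * (- \<gamma>0 a - (- wavg w \<gamma>0 G))) = - dev \<gamma>0"
    unfolding dev_def sum_negf[symmetric] by (intro sum.cong) (auto simp: algebra_simps)
  ultimately show ?thesis
    using convex_quadratic_nonneg[of "dev (\<lambda>\<eta>. \<eta>)" "dev \<gamma>0" s t "dev u0"] assms
    unfolding expand by simp
qed

section \<open>The invariant and its direct consequences\<close>

text \<open>
  The invariant of the dynamics. Down-closed sets \<open>D\<close> are used for the cuts because both
  \<open>{..<\<alpha>}\<close> (left endpoints) and \<open>{..\<beta>}\<close> (right endpoints) occur. The last clause is required for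
  all later times, as if \<open>G\<close> never collided again: for the initial singletons this is trivial,
  whereas the convexity argument would need \<open>0 < s\<close>.
\<close>

definition admissible :: "real \<Rightarrow> real set set \<Rightarrow> bool" where
  "admissible s \<xi> \<longleftrightarrow> 0 \<le> s \<and> \<Union>\<xi> = X \<and> {} \<notin> \<xi> \<and>
     (\<forall>G\<in>\<xi>. \<forall>G'\<in>\<xi>. G \<noteq> G' \<longrightarrow> pos G s \<noteq> pos G' s) \<and>
     (\<forall>G\<in>\<xi>. \<forall>G'\<in>\<xi>. pos G s < pos G' s \<longrightarrow> (\<forall>a\<in>G. \<forall>b\<in>G'. a < b)) \<and>
     (\<forall>G\<in>\<xi>. \<forall>t\<ge>s. \<forall>D. (\<forall>a\<in>D. {..a} \<subseteq> D) \<longrightarrow>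
        0 \<le> (\<Sum>a\<in>G \<inter> D. w a * (flow t a - pos G t)))"

lemma admissibleI:
  assumes "0 \<le> s" "\<Union>\<xi> = X" "{} \<notin> \<xi>"
    and "\<And>G G'. G \<in> \<xi> \<Longrightarrow> G' \<in> \<xi> \<Longrightarrow> pos G s = pos G' s \<Longrightarrow> G = G'"
    and "\<And>G G' a b. G \<in> \<xi> \<Longrightarrow> G' \<in> \<xi> \<Longrightarrow> pos G s < pos G' s \<Longrightarrow> a \<in> G \<Longrightarrow> b \<in> G' \<Longrightarrow> a < b"
    and "\<And>G t D. G \<in> \<xi> \<Longrightarrow> s \<le> t \<Longrightarrow> \<forall>a\<in>D. {..a} \<subseteq> D \<Longrightarrow>
      0 \<le> (\<Sum>a\<in>G \<inter> D. w a * (flow t a - pos G t))"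
  shows "admissible s \<xi>"
  unfolding admissible_def
proof (intro conjI ballI allI impI)
  show "pos G s \<noteq> pos G' s" if "G \<in> \<xi>" "G' \<in> \<xi>" "G \<noteq> G'" for G G'
    using assms(4) that by metis
  show "a < b" if "G \<in> \<xi>" "G' \<in> \<xi>" "pos G s < pos G' s" "a \<in> G" "b \<in> G'" for G G' a b
    using assms(5) that .
  show "0 \<le> (\<Sum>a\<in>G \<inter> D. w a * (flow t a - pos G t))"
    if "G \<in> \<xi>" "s \<le> t" "\<forall>a\<in>D. {..a} \<subseteq> D" for G t D
    using assms(6) that .
qed (fact assms(1) assms(2) assms(3))+

lemma admissible_nonneg: "admissible s \<xi> \<Longrightarrow> 0 \<le> s"
  and admissible_Union: "admissible s \<xi> \<Longrightarrow> \<Union>\<xi> = X"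
  and admissible_nonempty: "admissible s \<xi> \<Longrightarrow> G \<in> \<xi> \<Longrightarrow> G \<noteq> {}"
  by (auto simp: admissible_def)

lemma admissible_subset: "admissible s \<xi> \<Longrightarrow> G \<in> \<xi> \<Longrightarrow> G \<subseteq> X"
  using admissible_Union by blast

lemma admissible_inj:
  "admissible s \<xi> \<Longrightarrow> G \<in> \<xi> \<Longrightarrow> G' \<in> \<xi> \<Longrightarrow> pos G s = pos G' s \<Longrightarrow> G = G'"
  by (auto simp: admissible_def)

lemma admissible_ordered:
  assumes "admissible s \<xi>" "G \<in> \<xi>" "G' \<in> \<xi>" "pos G s < pos G' s" "a \<in> G" "b \<in> G'"
  shows "a < b"
proof -
  have "\<forall>G\<in>\<xi>. \<forall>G'\<in>\<xi>. pos G s < pos G' s \<longrightarrow> (\<forall>a\<in>G. \<forall>b\<in>G'. a < b)"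
    using assms(1) unfolding admissible_def by (elim conjE)
  then show ?thesis using assms(2-) by blast
qed

lemma admissible_lower:
  assumes "admissible s \<xi>" "G \<in> \<xi>" "s \<le> t" "\<forall>a\<in>D. {..a} \<subseteq> D"
  shows "0 \<le> (\<Sum>a\<in>G \<inter> D. w a * (flow t a - pos G t))"
proof -
  have "\<forall>G\<in>\<xi>. \<forall>t\<ge>s. \<forall>D. (\<forall>a\<in>D. {..a} \<subseteq> D) \<longrightarrow>
      0 \<le> (\<Sum>a\<in>G \<inter> D. w a * (flow t a - pos G t))"
    using assms(1) unfolding admissible_def by (elim conjE)
  from this[rule_format, OF assms(2,3), of D] show ?thesis using assms(4) by simp
qed

text \<open>Disjointness is not a separate clause of the invariant: if the positions differed, the
  order clause would give \<open>a < a\<close>.\<close>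

lemma admissible_disjoint:
  assumes "admissible s \<xi>" "G \<in> \<xi>" "G' \<in> \<xi>" "a \<in> G" "a \<in> G'"
  shows "G = G'"
  using admissible_inj[OF assms(1-3)] admissible_ordered[OF assms(1-3) _ assms(4,5)]
    admissible_ordered[OF assms(1,3,2) _ assms(5,4)]
  by (metis less_irrefl linorder_less_linear)

lemma admissible_finite: "admissible s \<xi> \<Longrightarrow> finite \<xi>"
  using finite_X admissible_Union by (metis finite_UnionD)

lemma finite_cluster: "admissible s \<xi> \<Longrightarrow> G \<in> \<xi> \<Longrightarrow> finite G"
  by (rule finite_subset[OF admissible_subset finite_X])

text \<open>The deviations over the whole cluster cancel, so the upper part balances the lower
  one.\<close>

lemma admissible_upper:
  assumes "admissible s \<xi>" "G \<in> \<xi>" "s \<le> t" "\<forall>a\<in>D. {..a} \<subseteq> D"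
  shows "(\<Sum>a\<in>G - D. w a * (flow t a - pos G t)) \<le> 0"
proof -
  have G: "G \<subseteq> X" "G \<noteq> {}" using assms admissible_subset admissible_nonempty by blast+
  then have "(\<Sum>a\<in>G. w a * (flow t a - pos G t)) = 0"
    using sum_deviation_cluster[OF G, of "flow t"] pos_eq by simp
  moreover have "finite G" using finite_cluster[OF assms(1,2)] .
  ultimately show ?thesis
    using sum.Int_Diff[of G "\<lambda>a. w a * (flow t a - pos G t)" D] admissible_lower[OF assms] by simp
qed

lemma sum_Union_admissible:
  fixes f :: "real \<Rightarrow> real"
  assumes "admissible s \<xi>" "\<A> \<subseteq> \<xi>"
  shows "sum f (\<Union>\<A> \<inter> D) = (\<Sum>G\<in>\<A>. sum f (G \<inter> D))"
proof -
  have "\<Union>\<A> \<inter> D = (\<Union>G\<in>\<A>. G \<inter> D)" by auto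
  moreover have "finite \<A>" using finite_subset[OF assms(2) admissible_finite[OF assms(1)]] .
  moreover have "finite G" if "G \<in> \<A>" for G
    using that assms finite_cluster by blast
  moreover have "G \<inter> D \<inter> (G' \<inter> D) = {}" if "G \<in> \<A>" "G' \<in> \<A>" "G \<noteq> G'" for G G'
    using that assms admissible_disjoint by blast
  ultimately show ?thesis using sum.UNION_disjoint[of \<A> "\<lambda>G. G \<inter> D" f] by auto
qed

text \<open>A singleton follows the free path of its particle, so its deviations vanish at all
  times; at time 0 the flow is the identity, which gives the order.\<close>

lemma admissible_initial: "admissible 0 {{p} | p. p \<in> X}"
proof -
  have single: "pos {p} t = flow t p" if "p \<in> X" for p t
    using that w_pos[of p] by (simp add: pos_eq wavg_def)
  have "0 \<le> (\<Sum>a\<in>{p} \<inter> D. w a * (flow t a - pos {p} t))" if "p \<in> X" for p t D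
    by (rule sum_nonneg) (use that single in auto)
  with single show ?thesis by (intro admissibleI) (auto simp: free_path_def)
qed

section \<open>Evolution between shocks and merging at a shock\<close>

abbreviation "shock \<equiv> next_shock N x m u0 \<gamma>0"
abbreviation "merging \<equiv> merge_clusters N x m u0 \<gamma>0"

lemma before_shock:
  assumes "ereal s < ereal t" "ereal t < shock (ereal s) \<xi>" "G \<in> \<xi>" "G' \<in> \<xi>" "G \<noteq> G'"
  shows "pos G t \<noteq> pos G' t"
proof
  assume "pos G t = pos G' t"
  then have "shock (ereal s) \<xi> \<le> ereal t"
    unfolding next_shock_def using assms by (intro Inf_lower) auto
  then show False using assms by simp
qed

text \<open>Otherwise the two clusters would have exchanged their order since \<open>s\<close>,
  hence met in between by the intermediate value theorem. The strict inequality at \<open>t\<close>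
  puts that meeting before \<open>t\<close>, so \<open>t\<close> may be the shock time itself, as
  merging requires.\<close>

lemma order_until_shock:
  assumes adm: "admissible s \<xi>" and "s \<le> t" "ereal t \<le> shock (ereal s) \<xi>"
    and G: "G \<in> \<xi>" "G' \<in> \<xi>" and less: "pos G t < pos G' t"
    and ab: "a \<in> G" "b \<in> G'"
  shows "a < b"
proof (rule ccontr)
  assume "\<not> a < b"
  then have "\<not> pos G s < pos G' s" "G \<noteq> G'"
    using admissible_ordered[OF adm G _ ab] less by auto
  then have gt: "pos G' s < pos G s" using admissible_inj[OF adm G] by force
  have "\<exists>r. s \<le> r \<and> r \<le> t \<and> pos G r - pos G' r = 0"
  proof (rule IVT2')
    show "continuous_on {s..t} (\<lambda>r. pos G r - pos G' r)"
      using admissible_subset[OF adm] G by (intro continuous_intros continuous_pos)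
  qed (use gt less \<open>s \<le> t\<close> in auto)
  then obtain r where r: "s \<le> r" "r \<le> t" "pos G r = pos G' r" by auto
  moreover have "r \<noteq> s" "r \<noteq> t" using r gt less by auto
  ultimately have "s < r" "r < t" by auto
  moreover then have "ereal r < shock (ereal s) \<xi>"
    using assms(3) by (metis less_ereal.simps(1) less_le_trans)
  ultimately show False
    using before_shock[of s r \<xi> G G'] G \<open>G \<noteq> G'\<close> r(3) by auto
qed

lemma admissible_until_shock:
  assumes "admissible s \<xi>" "s \<le> t" "ereal t < shock (ereal s) \<xi>"
  shows "admissible t \<xi>"
proof -
  show ?thesis
  proof (rule admissibleI)
    show "0 \<le> t" "\<Union>\<xi> = X" "{} \<notin> \<xi>"
      using assms(1,2) admissible_nonneg admissible_Union admissible_nonempty by force+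
    \<comment> \<open>\<open>before_shock\<close> covers only times after \<open>s\<close>; for
      \<open>t = s\<close> the invariant at \<open>s\<close> is used.\<close>
    show "G = G'" if "G \<in> \<xi>" "G' \<in> \<xi>" "pos G t = pos G' t" for G G'
      using before_shock[of s t \<xi> G G'] admissible_inj[OF assms(1)] assms that
      by (cases "s = t") auto
    show "a < b" if "G \<in> \<xi>" "G' \<in> \<xi>" "pos G t < pos G' t" "a \<in> G" "b \<in> G'" for G G' a b
      using order_until_shock[OF assms(1,2) _ that] assms(3) by simp
    show "0 \<le> (\<Sum>a\<in>G \<inter> D. w a * (flow t' a - pos G t'))"
      if "G \<in> \<xi>" "t \<le> t'" "\<forall>a\<in>D. {..a} \<subseteq> D" for G t' D
      using admissible_lower[OF assms(1)] that assms(2) by simp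
  qed
qed

text \<open>The collision times form a closed set bounded below, so a finite infimum is a minimum.
  Hence two clusters really meet at a finite shock time, which makes their number drop.\<close>

lemma shock_attained:
  assumes adm: "admissible s \<xi>" and "shock (ereal s) \<xi> \<noteq> \<infinity>"
  obtains s' G G' where "shock (ereal s) \<xi> = ereal s'" "s < s'" "G \<in> \<xi>" "G' \<in> \<xi>" "G \<noteq> G'"
    "pos G s' = pos G' s'"
proof -
  \<comment> \<open>The closed ray \<open>{s..}\<close> makes \<open>C\<close> closed. Clusters have
    distinct positions at time \<open>s\<close>, so \<open>s\<close> is not in \<open>C\<close> and
    the strict inequality in the shock definition is recovered.\<close>
  define C where "C = (\<Union>(G, G') \<in> {(G, G') \<in> \<xi> \<times> \<xi>. G \<noteq> G'}. {t \<in> {s..}. pos G t = pos G' t})"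
  have C_iff: "t \<in> C \<longleftrightarrow> s < t \<and> (\<exists>G\<in>\<xi>. \<exists>G'\<in>\<xi>. G \<noteq> G' \<and> pos G t = pos G' t)" for t
    unfolding C_def using admissible_inj[OF adm] by (auto simp: le_less)
  have shock_eq: "shock (ereal s) \<xi> = Inf (ereal ` C)"
  proof -
    have "C = {t. ereal s < ereal t \<and> (\<exists>G\<in>\<xi>. \<exists>G'\<in>\<xi>. G \<noteq> G' \<and> pos G t = pos G' t)}"
      by (simp add: set_eq_iff C_iff)
    then show ?thesis unfolding next_shock_def setcompr_eq_image by simp
  qed
  have "closed C"
    unfolding C_def
  proof (rule closed_UN)
    have "{(G, G') \<in> \<xi> \<times> \<xi>. G \<noteq> G'} \<subseteq> \<xi> \<times> \<xi>" by auto
    then show "finite {(G, G') \<in> \<xi> \<times> \<xi>. G \<noteq> G'}"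
      using admissible_finite[OF adm] by (meson finite_SigmaI finite_subset)
    show "\<forall>p\<in>{(G, G') \<in> \<xi> \<times> \<xi>. G \<noteq> G'}. closed (case p of (G, G') \<Rightarrow> {t \<in> {s..}. pos G t = pos G' t})"
      using admissible_subset[OF adm]
      by (auto intro!: closed_Collect_conj closed_Collect_le closed_Collect_eq continuous_pos)
  qed
  moreover have "C \<noteq> {}"
    using assms(2) unfolding shock_eq by (auto simp: top_ereal_def)
  moreover have "bdd_below C" by (rule bdd_belowI[of _ s]) (auto simp: C_iff)
  ultimately have "Inf C \<in> C" by (intro closed_contains_Inf)
  moreover then have "Inf (ereal ` C) = ereal (Inf C)"
    using \<open>bdd_below C\<close> by (intro Inf_eqI) (auto intro: cInf_lower)
  ultimately show ?thesis
    using that shock_eq C_iff by metis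
qed

text \<open>The deviations from the common position cancel within each merging cluster, hence on
  their union: merging causes no jump.\<close>

lemma pos_merged:
  assumes adm: "admissible s \<xi>" and G: "G \<in> \<xi>"
  shows "pos (\<Union>{G' \<in> \<xi>. pos G' t = pos G t}) t = pos G t" (is "pos (\<Union>?\<A>) t = _")
proof -
  have sub: "\<Union>?\<A> \<subseteq> X" and "\<Union>?\<A> \<noteq> {}"
    using admissible_subset[OF adm] admissible_nonempty[OF adm] G by auto
  have "(\<Sum>a\<in>\<Union>?\<A>. w a * (flow t a - pos G t))
      = (\<Sum>G'\<in>?\<A>. \<Sum>a\<in>G'. w a * (flow t a - pos G t))"
    using sum_Union_admissible[OF adm, of ?\<A> _ UNIV] by simp
  also have "\<dots> = 0"
  proof (rule sum.neutral, safe)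
    fix G' assume "G' \<in> \<xi>" "pos G' t = pos G t"
    then show "(\<Sum>a\<in>G'. w a * (flow t a - pos G t)) = 0"
      using sum_deviation_cluster[of G' "flow t"] pos_eq[of G' t]
        admissible_subset[OF adm] admissible_nonempty[OF adm] by simp
  qed
  finally show ?thesis
    using wavg_less_iff(3)[of "\<Union>?\<A>" w "flow t" "pos G t"] sub \<open>\<Union>?\<A> \<noteq> {}\<close> w_pos finite_X
    by (auto simp: pos_eq[OF sub] dest: finite_subset)
qed

text \<open>Merging collects all clusters at one position, so merged clusters have distinct
  positions, and \<open>order_until_shock\<close> at the shock itself orders their members. The
  lower-part clause is checked at \<open>s'\<close> and carried on by convexity, which applies
  because \<open>s'\<close> is positive.\<close>

lemma admissible_merge:
  assumes adm: "admissible s \<xi>" and "s < s'" and s': "shock (ereal s) \<xi> = ereal s'"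
  shows "admissible s' (merging s' \<xi>)"
proof -
  \<comment> \<open>\<open>h G\<close> is the merged cluster that absorbs \<open>G\<close>.\<close>
  define h where "h G = \<Union>{G' \<in> \<xi>. pos G' s' = pos G s'}" for G
  have merge: "merging s' \<xi> = h ` \<xi>" unfolding merge_clusters_def h_def by auto
  have pos_h: "pos (h G) s' = pos G s'" if "G \<in> \<xi>" for G
    unfolding h_def using pos_merged[OF adm that] .
  have h_sup: "G \<subseteq> h G" if "G \<in> \<xi>" for G using that unfolding h_def by auto
  have "0 < s'" using admissible_nonneg[OF adm] \<open>s < s'\<close> by simp
  have hX: "h G \<subseteq> X" for G using admissible_subset[OF adm] unfolding h_def by auto
  have h_nonempty: "h G \<noteq> {}" if "G \<in> \<xi>" for G
    using h_sup[OF that] admissible_nonempty[OF adm that] by auto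
  have X: "X \<subseteq> \<Union>(h ` \<xi>)" using admissible_Union[OF adm] h_sup by blast
  have inj: "h G = h G'" if "G \<in> \<xi>" "G' \<in> \<xi>" "pos (h G) s' = pos (h G') s'" for G G'
    using that pos_h unfolding h_def by simp
  have ordered: "a < b" if hyps: "G \<in> \<xi>" "G' \<in> \<xi>" "pos (h G) s' < pos (h G') s'" "a \<in> h G" "b \<in> h G'"
    for G G' a b
  proof -
    obtain H H' where "H \<in> \<xi>" "a \<in> H" "pos H s' = pos G s'" "H' \<in> \<xi>" "b \<in> H'" "pos H' s' = pos G' s'"
      using hyps(4,5) unfolding h_def by auto
    then show ?thesis
      using order_until_shock[OF adm, of s' H H' a b] \<open>s < s'\<close> s' pos_h hyps(1,2,3) by simp
  qed
  have lower: "0 \<le> (\<Sum>a\<in>h G \<inter> D. w a * (flow t a - pos (h G) t))"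
    if G: "G \<in> \<xi>" and "s' \<le> t" and D: "\<forall>a\<in>D. {..a} \<subseteq> D" for G t D
  proof (rule lower_part_stays_ahead[OF hX h_nonempty[OF G] D \<open>0 < s'\<close> \<open>s' \<le> t\<close>])
    \<comment> \<open>At time \<open>s'\<close> the merged cluster and its constituents share one
      position, so all deviations refer to the same point and add up.\<close>
    have "(\<Sum>a\<in>h G \<inter> D. w a * (flow s' a - pos (h G) s'))
        = (\<Sum>G' | G' \<in> \<xi> \<and> pos G' s' = pos G s'. \<Sum>a\<in>G' \<inter> D. w a * (flow s' a - pos G s'))"
      unfolding pos_h[OF G] unfolding h_def by (rule sum_Union_admissible[OF adm]) auto
    also have "\<dots> \<ge> 0"
    proof (rule sum_nonneg)
      fix G' assume "G' \<in> {G' \<in> \<xi>. pos G' s' = pos G s'}"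
      then show "0 \<le> (\<Sum>a\<in>G' \<inter> D. w a * (flow s' a - pos G s'))"
        using admissible_lower[OF adm, of G' s' D] D \<open>s < s'\<close> by simp
    qed
    finally show "0 \<le> (\<Sum>a\<in>h G \<inter> D. w a * (flow s' a - pos (h G) s'))" .
  qed
  show ?thesis
    unfolding merge
  proof (rule admissibleI)
    show "\<Union>(h ` \<xi>) = X" using X hX by blast
    show "{} \<notin> h ` \<xi>" using h_nonempty by auto
    show "0 \<le> s'" using \<open>0 < s'\<close> by simp
    show "H = H'" if "H \<in> h ` \<xi>" "H' \<in> h ` \<xi>" "pos H s' = pos H' s'" for H H'
      using that inj by blast
    show "a < b" if "H \<in> h ` \<xi>" "H' \<in> h ` \<xi>" "pos H s' < pos H' s'" "a \<in> H" "b \<in> H'" for H H' a b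
      using that ordered by blast
    show "0 \<le> (\<Sum>a\<in>H \<inter> D. w a * (flow t a - pos H t))"
      if "H \<in> h ` \<xi>" "s' \<le> t" "\<forall>a\<in>D. {..a} \<subseteq> D" for H t D
      using lower[OF _ that(2,3)] that(1) by blast
  qed
qed

text \<open>The map from a cluster to the merged one containing it identifies \<open>G\<close> and
  \<open>G'\<close>, so its image is smaller than its domain.\<close>

lemma card_merge:
  assumes "finite \<xi>" "G \<in> \<xi>" "G' \<in> \<xi>" "G \<noteq> G'" "pos G t = pos G' t"
  shows "card (merging t \<xi>) < card \<xi>"
proof -
  define h where "h G = \<Union>{G' \<in> \<xi>. pos G' t = pos G t}" for G
  have "merging t \<xi> = h ` \<xi>" unfolding merge_clusters_def h_def by auto
  moreover have "h G = h G'" unfolding h_def assms(5) ..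
  then have "\<not> inj_on h \<xi>" using assms(2-4) by (auto dest: inj_onD)
  ultimately show ?thesis
    using assms(1) by (metis card_image_le eq_card_imp_inj_on le_neq_implies_less)
qed

section \<open>The sequence of shock states\<close>

abbreviation "state \<equiv> shock_state N x m u0 \<gamma>0"

text \<open>There are \<open>N\<close> clusters at first and every finite shock removes at least
  one, which pays for the growth of \<open>k\<close>. In particular the time of state
  \<open>Suc N\<close> is infinite.\<close>

lemma state_cases:
  "fst (state k) = \<infinity> \<or>
    (\<exists>s. fst (state k) = ereal s \<and> admissible s (snd (state k)) \<and> k + card (snd (state k)) \<le> N)"
proof (induction k)
  case 0
  have "{{p} | p. p \<in> X} = (\<lambda>p. {p}) ` X" by auto
  then have "card {{p} | p. p \<in> X} = N" using card_X by (simp add: card_image)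
  then show ?case using admissible_initial by (auto simp: zero_ereal_def)
next
  case (Suc k)
  obtain s \<xi> where st: "state k = (s, \<xi>)" by (cases "state k")
  show ?case
  proof (cases "shock s \<xi> = \<infinity>")
    case True
    then show ?thesis using st by simp
  next
    case False
    \<comment> \<open>No time lies after infinity, and the infimum of the empty set is infinity, so
      a finite next shock forces the current time to be finite.\<close>
    have "shock \<infinity> \<xi> = \<infinity>" unfolding next_shock_def by (simp add: top_ereal_def)
    with False have "s \<noteq> \<infinity>" by auto
    then obtain r where r: "s = ereal r" "admissible r \<xi>" "k + card \<xi> \<le> N"
      using Suc st by auto
    obtain r' G G' where r': "shock s \<xi> = ereal r'" "r < r'" "G \<in> \<xi>" "G' \<in> \<xi>" "G \<noteq> G'"
      "pos G r' = pos G' r'"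
      using shock_attained[OF r(2)] False r(1) by metis
    have "card (merging r' \<xi>) < card \<xi>"
      using card_merge[OF admissible_finite[OF r(2)] r'(3-6)] .
    then show ?thesis
      using st r r' admissible_merge[OF r(2) r'(2)] by simp
  qed
qed

lemma state_mono: "fst (state k) \<le> fst (state (Suc k))"
proof -
  obtain s \<xi> where "state k = (s, \<xi>)" by (cases "state k")
  moreover have "s \<le> shock s \<xi>" unfolding next_shock_def by (intro Inf_greatest) auto
  ultimately show ?thesis by (simp add: Let_def)
qed

lemma admissible_clusters:
  assumes "0 \<le> t"
  shows "admissible t (clusters N x m u0 \<gamma>0 t)"
proof -
  let ?P = "\<lambda>k. fst (state k) \<le> ereal t \<and> ereal t < fst (state (Suc k))"
  have "fst (state (Suc N)) = \<infinity>" using state_cases[of "Suc N"] by auto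
  then have ex: "\<exists>k. ereal t < fst (state (Suc k))" by (metis less_ereal.simps(4))
  \<comment> \<open>The least index whose next shock lies beyond \<open>t\<close>: its own time is
    at most \<open>t\<close> by minimality, or because the time of state 0 is 0.\<close>
  define k where "k = (LEAST k. ereal t < fst (state (Suc k)))"
  have "ereal t < fst (state (Suc k))" unfolding k_def using ex by (rule LeastI_ex)
  moreover have "fst (state k) \<le> ereal t"
  proof (cases k)
    case 0
    then show ?thesis using assms by simp
  next
    case (Suc i)
    then show ?thesis using not_less_Least[of i "\<lambda>k. ereal t < fst (state (Suc k))"]
      unfolding k_def by (metis lessI not_less)
  qed
  ultimately have k: "?P k" by (rule conjI[rotated])
  have mono: "fst (state i) \<le> fst (state j)" if "i \<le> j" for i j
    using lift_Suc_mono_le[of "\<lambda>k. fst (state k)", OF state_mono that] .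
  \<comment> \<open>Of two different indices, the smaller one would have its whole time interval
    before that of the other, so \<open>t\<close> cannot lie in both. This evaluates the
    \<open>THE\<close> in \<open>clusters\<close>.\<close>
  have "l = k" if "?P l" for l
    using k that mono[of "Suc k" l] mono[of "Suc l" k] by (meson leD le_less_trans not_less_eq_eq
        less_le_trans order_antisym)
  then have "(THE k. ?P k) = k" using k by (rule the_equality[rotated])
  then have cl: "clusters N x m u0 \<gamma>0 t = snd (state k)" unfolding clusters_def by simp
  obtain s where s: "fst (state k) = ereal s" "admissible s (snd (state k))"
    using state_cases[of k] k by auto
  have "ereal t < shock (ereal s) (snd (state k))"
    using k s(1) by (cases "state k") (simp add: Let_def)
  then show ?thesis
    unfolding cl using admissible_until_shock[OF s(2)] k s(1) by simp
qed

section \<open>Averages on both sides of a cut\<close>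

text \<open>The position of the cluster lies between the two averages.\<close>

lemma wavg_cut_cluster:
  assumes adm: "admissible t \<xi>" and G: "G \<in> \<xi>" and D: "\<forall>a\<in>D. {..a} \<subseteq> D"
    and ne: "G \<inter> D \<noteq> {}" "G - D \<noteq> {}"
  shows "wavg w (flow t) (G - D) \<le> wavg w (flow t) (G \<inter> D)"
proof -
  have "finite G" "\<And>a. a \<in> G \<Longrightarrow> 0 < w a"
    using finite_cluster[OF adm G] admissible_subset[OF adm G] w_pos by auto
  then have "wavg w (flow t) (G - D) \<le> pos G t" "pos G t \<le> wavg w (flow t) (G \<inter> D)"
    using ne wavg_le_iff(1)[where A = "G - D" and w = w and f = "flow t" and c = "pos G t"]
      wavg_le_iff(2)[where A = "G \<inter> D" and w = w and f = "flow t" and c = "pos G t"]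
      admissible_lower[OF adm G order_refl D] admissible_upper[OF adm G order_refl D]
    by auto
  then show ?thesis by simp
qed

text \<open>The rightmost cluster position \<open>c\<close> below the cut separates the averages.
  Clusters below the cut contribute only upper parts (beyond \<open>E\<close>), with mean at most
  \<open>c\<close>; clusters above it contribute only lower parts (within \<open>F\<close>), with
  mean greater than \<open>c\<close>. Thus \<open>E\<close> and \<open>F\<close> may cut through
  clusters, while \<open>D\<close> may not.\<close>

lemma wavg_cut_between_clusters:
  assumes adm: "admissible t \<xi>" and cut: "\<forall>G\<in>\<xi>. G \<subseteq> D \<or> G \<inter> D = {}"
    and D: "\<forall>a\<in>D. {..a} \<subseteq> D" and E: "\<forall>a\<in>E. {..a} \<subseteq> E" and F: "\<forall>a\<in>F. {..a} \<subseteq> F"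
    and ne: "X \<inter> (D - E) \<noteq> {}" "X \<inter> (F - D) \<noteq> {}"
  shows "wavg w (flow t) (X \<inter> (D - E)) < wavg w (flow t) (X \<inter> (F - D))"
proof -
  have X: "X = \<Union>\<xi>" using admissible_Union[OF adm] by simp
  define c where "c = Max ((\<lambda>G. pos G t) ` {G \<in> \<xi>. G \<subseteq> D})"
  have fin: "finite {G \<in> \<xi>. G \<subseteq> D}" using admissible_finite[OF adm] by simp
  have left: "pos G t \<le> c" if "G \<in> \<xi>" "G \<subseteq> D" for G
    unfolding c_def using fin that by (intro Max_ge) auto
  have "{G \<in> \<xi>. G \<subseteq> D} \<noteq> {}" using ne(1) cut unfolding X by blast
  then have "c \<in> (\<lambda>G. pos G t) ` {G \<in> \<xi>. G \<subseteq> D}"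
    unfolding c_def using fin by (intro Max_in) auto
  then obtain H where H: "H \<in> \<xi>" "H \<subseteq> D" "pos H t = c" by auto
  \<comment> \<open>A cluster above the cut with position at most \<open>c\<close> would have its
    particles below those of \<open>H\<close>, hence inside the down-closed set
    \<open>D\<close>.\<close>
  have right: "c < pos G t" if G: "G \<in> \<xi>" "G \<inter> D = {}" for G
  proof (rule ccontr)
    assume "\<not> c < pos G t"
    moreover obtain a b where ab: "a \<in> G" "b \<in> H" using admissible_nonempty[OF adm] G H by blast
    moreover have "G \<noteq> H" using ab H G by auto
    ultimately have "a < b"
      using admissible_ordered[OF adm G(1) H(1)] admissible_inj[OF adm G(1) H(1)] H(3) by force
    moreover have "{..b} \<subseteq> D" using D H(2) ab(2) by blast
    ultimately have "a \<in> D" by auto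
    then show False using ab(1) G(2) by blast
  qed
  have fX: "finite (X \<inter> A)" for A using finite_X by simp
  have "(\<Sum>a\<in>X \<inter> (D - E). w a * (flow t a - c)) = (\<Sum>G\<in>\<xi>. \<Sum>a\<in>G \<inter> (D - E). w a * (flow t a - c))"
    unfolding X by (rule sum_Union_admissible[OF adm order_refl])
  also have "\<dots> \<le> 0"
  proof (rule sum_nonpos)
    fix G assume G: "G \<in> \<xi>"
    show "(\<Sum>a\<in>G \<inter> (D - E). w a * (flow t a - c)) \<le> 0"
    proof (cases "G \<subseteq> D")
      case True
      then have eq: "G \<inter> (D - E) = G - E" by auto
      have "(\<Sum>a\<in>G - E. w a * (flow t a - c)) \<le> (\<Sum>a\<in>G - E. w a * (flow t a - pos G t))"
        using left[OF G True] admissible_subset[OF adm G] w_pos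
        by (intro sum_mono mult_left_mono) (auto intro: less_imp_le)
      also have "\<dots> \<le> 0" by (rule admissible_upper[OF adm G order_refl E])
      finally show ?thesis unfolding eq .
    next
      case False
      then have "G \<inter> (D - E) = {}" using cut G by auto
      then show ?thesis by simp
    qed
  qed
  finally have "wavg w (flow t) (X \<inter> (D - E)) \<le> c"
    using wavg_le_iff(1)[OF fX ne(1)] w_pos by simp
  moreover
  have "0 < (\<Sum>G\<in>\<xi>. \<Sum>a\<in>G \<inter> (F - D). w a * (flow t a - c))"
  proof -
    have pos: "0 < (\<Sum>a\<in>G \<inter> (F - D). w a * (flow t a - c))"
      if G: "G \<in> \<xi>" and nonempty: "G \<inter> (F - D) \<noteq> {}" for G
    proof -
      have dis: "G \<inter> D = {}" using cut G nonempty by auto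
      then have eq: "G \<inter> (F - D) = G \<inter> F" by auto
      have "0 \<le> (\<Sum>a\<in>G \<inter> F. w a * (flow t a - pos G t))"
        by (rule admissible_lower[OF adm G order_refl F])
      also have "\<dots> < (\<Sum>a\<in>G \<inter> F. w a * (flow t a - c))"
        using right[OF G dis] admissible_subset[OF adm G] w_pos nonempty finite_cluster[OF adm G]
        by (intro sum_strict_mono mult_strict_left_mono) (auto simp: eq)
      finally show ?thesis unfolding eq .
    qed
    \<comment> \<open>One cluster meeting \<open>F - D\<close> makes the total strictly positive;
      clusters missing it contribute empty sums.\<close>
    obtain G0 where "G0 \<in> \<xi>" "G0 \<inter> (F - D) \<noteq> {}" using ne(2) unfolding X by blast
    then show ?thesis
      using pos admissible_finite[OF adm]
      by (intro sum_pos2[of _ G0]) (auto, metis less_imp_le sum.empty order_refl)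
  qed
  then have "0 < (\<Sum>a\<in>X \<inter> (F - D). w a * (flow t a - c))"
    unfolding X sum_Union_admissible[OF adm order_refl] .
  then have "c < wavg w (flow t) (X \<inter> (F - D))"
    using wavg_less_iff(2)[OF fX ne(2)] w_pos by simp
  ultimately show ?thesis by simp
qed

section \<open>Clusters as intervals and their endpoints\<close>

text \<open>A particle of another cluster lies above all of \<open>G\<close> or below all of it, so
  it cannot fall in between.\<close>

lemma cluster_interval:
  assumes adm: "admissible t \<xi>" and G: "G \<in> \<xi>"
  shows "X \<inter> {Min G..Max G} = G"
proof -
  have sub: "G \<subseteq> X" and "G \<noteq> {}" using admissible_subset[OF adm G] admissible_nonempty[OF adm G] by auto
  have fin: "finite G" using finite_cluster[OF adm G] .
  have "a \<in> G" if a: "a \<in> X" "Min G \<le> a" "a \<le> Max G" for a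
  proof (rule ccontr)
    assume "a \<notin> G"
    obtain G' where G': "G' \<in> \<xi>" "a \<in> G'" using admissible_Union[OF adm] a by auto
    with \<open>a \<notin> G\<close> have "pos G t \<noteq> pos G' t" using admissible_inj[OF adm G G'(1)] by auto
    then consider "pos G t < pos G' t" | "pos G' t < pos G t" by linarith
    then show False
    proof cases
      case 1
      then show ?thesis
        using admissible_ordered[OF adm G G'(1) 1 Max_in[OF fin \<open>G \<noteq> {}\<close>] G'(2)] a by simp
    next
      case 2
      then show ?thesis
        using admissible_ordered[OF adm G'(1) G 2 G'(2) Min_in[OF fin \<open>G \<noteq> {}\<close>]] a by simp
    qed
  qed
  then show ?thesis using sub fin by auto
qed

text \<open>Endpoints are rephrased as cuts that split no cluster, the form required by
  \<open>wavg_cut_between_clusters\<close>. Conversely, the cluster containing \<alpha> is not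
  inside \<open>{..<\<alpha>}\<close>, so it avoids this ray and \<alpha> is its minimum.\<close>

lemma left_endpoint_iff:
  assumes adm: "admissible t \<xi>" and "\<alpha> \<in> X"
  shows "(\<exists>G\<in>\<xi>. \<alpha> = Min G) \<longleftrightarrow> (\<forall>G\<in>\<xi>. G \<subseteq> {..<\<alpha>} \<or> G \<inter> {..<\<alpha>} = {})"
proof -
  have fin: "finite G" "G \<noteq> {}" if "G \<in> \<xi>" for G
    using that admissible_nonempty[OF adm] finite_cluster[OF adm] by auto
  show ?thesis
  proof
    assume "\<exists>G\<in>\<xi>. \<alpha> = Min G"
    then obtain G where G: "G \<in> \<xi>" "\<alpha> = Min G" by auto
    have \<alpha>: "\<alpha> \<in> G" "\<And>a. a \<in> G \<Longrightarrow> \<alpha> \<le> a" using fin[OF G(1)] G(2) by auto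
    show "\<forall>G\<in>\<xi>. G \<subseteq> {..<\<alpha>} \<or> G \<inter> {..<\<alpha>} = {}"
    proof
      fix G' assume G': "G' \<in> \<xi>"
      consider "G' = G" | "pos G t < pos G' t" | "pos G' t < pos G t"
        using admissible_inj[OF adm G(1) G'] by force
      then show "G' \<subseteq> {..<\<alpha>} \<or> G' \<inter> {..<\<alpha>} = {}"
        using admissible_ordered[OF adm G(1) G' _ \<alpha>(1)] admissible_ordered[OF adm G' G(1) _ _ \<alpha>(1)] \<alpha>(2)
        by cases (auto dest: leD less_asym)
    qed
  next
    assume cut: "\<forall>G\<in>\<xi>. G \<subseteq> {..<\<alpha>} \<or> G \<inter> {..<\<alpha>} = {}"
    obtain G where G: "G \<in> \<xi>" "\<alpha> \<in> G" using admissible_Union[OF adm] \<open>\<alpha> \<in> X\<close> by auto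
    then have "G \<inter> {..<\<alpha>} = {}" using cut by auto
    then have "\<alpha> = Min G" using fin[OF G(1)] G(2) by (intro Min_eqI[symmetric]) (auto simp: not_less[symmetric])
    then show "\<exists>G\<in>\<xi>. \<alpha> = Min G" using G by auto
  qed
qed

text \<open>The mirror image; the ray is closed because \<beta> now belongs to the part below the
  cut.\<close>

lemma right_endpoint_iff:
  assumes adm: "admissible t \<xi>" and "\<beta> \<in> X"
  shows "(\<exists>G\<in>\<xi>. \<beta> = Max G) \<longleftrightarrow> (\<forall>G\<in>\<xi>. G \<subseteq> {..\<beta>} \<or> G \<inter> {..\<beta>} = {})"
proof -
  have fin: "finite G" "G \<noteq> {}" if "G \<in> \<xi>" for G
    using that admissible_nonempty[OF adm] finite_cluster[OF adm] by auto
  show ?thesis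
  proof
    assume "\<exists>G\<in>\<xi>. \<beta> = Max G"
    then obtain G where G: "G \<in> \<xi>" "\<beta> = Max G" by auto
    have \<beta>: "\<beta> \<in> G" "\<And>a. a \<in> G \<Longrightarrow> a \<le> \<beta>" using fin[OF G(1)] G(2) by auto
    show "\<forall>G\<in>\<xi>. G \<subseteq> {..\<beta>} \<or> G \<inter> {..\<beta>} = {}"
    proof
      fix G' assume G': "G' \<in> \<xi>"
      consider "G' = G" | "pos G t < pos G' t" | "pos G' t < pos G t"
        using admissible_inj[OF adm G(1) G'] by force
      then show "G' \<subseteq> {..\<beta>} \<or> G' \<inter> {..\<beta>} = {}"
        using admissible_ordered[OF adm G(1) G' _ \<beta>(1)] admissible_ordered[OF adm G' G(1) _ _ \<beta>(1)] \<beta>(2)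
        by cases (auto dest: leD less_imp_le)
    qed
  next
    assume cut: "\<forall>G\<in>\<xi>. G \<subseteq> {..\<beta>} \<or> G \<inter> {..\<beta>} = {}"
    obtain G where G: "G \<in> \<xi>" "\<beta> \<in> G" using admissible_Union[OF adm] \<open>\<beta> \<in> X\<close> by auto
    then have "G \<subseteq> {..\<beta>}" using cut by auto
    then have "\<beta> = Max G" using fin[OF G(1)] G(2) by (intro Max_eqI[symmetric]) auto
    then show "\<exists>G\<in>\<xi>. \<beta> = Max G" using G by auto
  qed
qed

section \<open>Comparison of means for the mass measure\<close>

abbreviation "mean t \<equiv> mean_over (mass_measure N x m) (flow t)"

lemma mean_split_cluster:
  assumes adm: "admissible t \<xi>" and G: "G \<in> \<xi>" and D: "\<forall>a\<in>D. {..a} \<subseteq> D"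
    and L: "X \<inter> L = G \<inter> D" and R: "X \<inter> R = G - D"
    and ne: "G \<inter> D \<noteq> {}" "G - D \<noteq> {}"
  shows "mean t R \<le> mean t L"
  unfolding mean_over_eq L R by (rule wavg_cut_cluster[OF adm G D ne])

text \<open>Allows a window open on the right to end just after a cluster without reaching the next
  particle.\<close>

lemma gap_above: "\<exists>y>b. X \<inter> {b<..<y} = {}"
proof -
  obtain e where "e > 0" "\<forall>a\<in>X. a \<noteq> b \<longrightarrow> e \<le> dist b a"
    using finite_set_avoid[OF finite_X] by metis
  then have "b < b + e" "X \<inter> {b<..<b + e} = {}" by (auto simp: dist_real_def abs_if)
  then show ?thesis by blast
qed

lemma gap_below: "\<exists>y<b. X \<inter> {y<..<b} = {}"
proof -
  obtain e where "e > 0" "\<forall>a\<in>X. a \<noteq> b \<longrightarrow> e \<le> dist b a"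
    using finite_set_avoid[OF finite_X] by metis
  then have "b - e < b" "X \<inter> {b - e<..<b} = {}" by (auto simp: dist_real_def abs_if)
  then show ?thesis by blast
qed

text \<open>At a left endpoint the cut splits no cluster, so the means are strictly separated. If
  \<alpha> is no left endpoint, the cut splits some \<open>G\<close>, and windows covering exactly
  the two parts of \<open>G\<close> violate the inequality.\<close>

lemma mean_left_endpoint:
  assumes adm: "admissible t \<xi>" and \<alpha>: "\<alpha> \<in> X"
  shows "(\<exists>G\<in>\<xi>. \<alpha> = Min G) \<longleftrightarrow>
    (\<forall>y1 y2. y1 < \<alpha> \<and> \<alpha> < y2 \<and> measure (mass_measure N x m) {y1..<\<alpha>} > 0 \<longrightarrow>
       mean t {y1..<\<alpha>} < mean t {\<alpha>..<y2})"
  unfolding left_endpoint_iff[OF assms]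
proof (intro iffI allI impI)
  fix y1 y2
  assume cut: "\<forall>G\<in>\<xi>. G \<subseteq> {..<\<alpha>} \<or> G \<inter> {..<\<alpha>} = {}"
    and y: "y1 < \<alpha> \<and> \<alpha> < y2 \<and> measure (mass_measure N x m) {y1..<\<alpha>} > 0"
  \<comment> \<open>Both windows become differences of down-closed rays, with \<open>{..<y1}\<close>
    and \<open>{..<y2}\<close> in the roles of \<open>E\<close> and \<open>F\<close>.\<close>
  have eq: "{y1..<\<alpha>} = {..<\<alpha>} - {..<y1}" "{\<alpha>..<y2} = {..<y2} - {..<\<alpha>}" by auto
  have ne: "X \<inter> ({..<\<alpha>} - {..<y1}) \<noteq> {}" using y unfolding measure_pos_iff eq by blast
  \<comment> \<open>Positive mass is assumed for the left window only; the right one contains the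
    particle \<alpha>.\<close>
  have "\<alpha> \<in> X \<inter> ({..<y2} - {..<\<alpha>})" using y \<alpha> by auto
  then have "X \<inter> ({..<y2} - {..<\<alpha>}) \<noteq> {}" by blast
  then show "mean t {y1..<\<alpha>} < mean t {\<alpha>..<y2}"
    unfolding mean_over_eq eq by (intro wavg_cut_between_clusters[OF adm cut] ne) auto
next
  assume R: "\<forall>y1 y2. y1 < \<alpha> \<and> \<alpha> < y2 \<and> measure (mass_measure N x m) {y1..<\<alpha>} > 0 \<longrightarrow>
       mean t {y1..<\<alpha>} < mean t {\<alpha>..<y2}"
  show "\<forall>G\<in>\<xi>. G \<subseteq> {..<\<alpha>} \<or> G \<inter> {..<\<alpha>} = {}"
  proof (rule ccontr)
    assume "\<not> ?thesis"
    then obtain G where G: "G \<in> \<xi>" and ne: "G \<inter> {..<\<alpha>} \<noteq> {}" "G - {..<\<alpha>} \<noteq> {}" by blast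
    note fin = finite_cluster[OF adm G]
    note interval = cluster_interval[OF adm G]
    have "G \<noteq> {}" using ne by auto
    then have lo: "Min G < \<alpha>" and hi: "\<alpha> \<le> Max G"
      using ne fin by (auto simp: Min_less_iff Max_ge_iff not_less)
    \<comment> \<open>The right window excludes its end \<open>y\<close>, so \<open>y\<close> must
      exceed \<open>Max G\<close> to keep the whole upper part of \<open>G\<close>.\<close>
    obtain y where y: "Max G < y" "X \<inter> {Max G<..<y} = {}" using gap_above[of "Max G"] by blast
    have "X \<inter> {Min G..<\<alpha>} = X \<inter> {Min G..Max G} \<inter> {..<\<alpha>}" using hi by auto
    then have GL: "X \<inter> {Min G..<\<alpha>} = G \<inter> {..<\<alpha>}" unfolding interval .
    have "{\<alpha>..<y} = {\<alpha>..Max G} \<union> {Max G<..<y}" using hi y(1) by auto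
    then have "X \<inter> {\<alpha>..<y} = X \<inter> {\<alpha>..Max G}" using y(2) by (simp add: Int_Un_distrib)
    also have "\<dots> = X \<inter> {Min G..Max G} - {..<\<alpha>}" using lo by auto
    also have "\<dots> = G - {..<\<alpha>}" unfolding interval ..
    finally have GR: "X \<inter> {\<alpha>..<y} = G - {..<\<alpha>}" .
    have "mean t {\<alpha>..<y} \<le> mean t {Min G..<\<alpha>}"
      by (rule mean_split_cluster[OF adm G _ GL GR ne]) auto
    moreover have "measure (mass_measure N x m) {Min G..<\<alpha>} > 0"
      unfolding measure_pos_iff using GL ne by simp
    ultimately show False using R lo hi y(1) by (metis leD le_less_trans)
  qed
qed

text \<open>The mirror image of \<open>mean_left_endpoint\<close>: the window below the cut contains
  \<beta> and is open on the left, so in the converse it starts just before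
  \<open>Min G\<close>.\<close>

lemma mean_right_endpoint:
  assumes adm: "admissible t \<xi>" and \<beta>: "\<beta> \<in> X"
  shows "(\<exists>G\<in>\<xi>. \<beta> = Max G) \<longleftrightarrow>
    (\<forall>y1 y2. y1 < \<beta> \<and> \<beta> < y2 \<and> measure (mass_measure N x m) {\<beta><..y2} > 0 \<longrightarrow>
       mean t {y1<..\<beta>} < mean t {\<beta><..y2})"
  unfolding right_endpoint_iff[OF assms]
proof (intro iffI allI impI)
  fix y1 y2
  assume cut: "\<forall>G\<in>\<xi>. G \<subseteq> {..\<beta>} \<or> G \<inter> {..\<beta>} = {}"
    and y: "y1 < \<beta> \<and> \<beta> < y2 \<and> measure (mass_measure N x m) {\<beta><..y2} > 0"
  have eq: "{y1<..\<beta>} = {..\<beta>} - {..y1}" "{\<beta><..y2} = {..y2} - {..\<beta>}" by auto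
  have ne: "X \<inter> ({..y2} - {..\<beta>}) \<noteq> {}" using y unfolding measure_pos_iff eq by blast
  have "\<beta> \<in> X \<inter> ({..\<beta>} - {..y1})" using y \<beta> by auto
  then have "X \<inter> ({..\<beta>} - {..y1}) \<noteq> {}" by blast
  then show "mean t {y1<..\<beta>} < mean t {\<beta><..y2}"
    unfolding mean_over_eq eq by (intro wavg_cut_between_clusters[OF adm cut] ne) auto
next
  assume R: "\<forall>y1 y2. y1 < \<beta> \<and> \<beta> < y2 \<and> measure (mass_measure N x m) {\<beta><..y2} > 0 \<longrightarrow>
       mean t {y1<..\<beta>} < mean t {\<beta><..y2}"
  show "\<forall>G\<in>\<xi>. G \<subseteq> {..\<beta>} \<or> G \<inter> {..\<beta>} = {}"
  proof (rule ccontr)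
    assume "\<not> ?thesis"
    then obtain G where G: "G \<in> \<xi>" and ne: "G \<inter> {..\<beta>} \<noteq> {}" "G - {..\<beta>} \<noteq> {}" by blast
    note fin = finite_cluster[OF adm G]
    note interval = cluster_interval[OF adm G]
    have "G \<noteq> {}" using ne by auto
    then have lo: "Min G \<le> \<beta>" and hi: "\<beta> < Max G"
      using ne fin by (auto simp: Min_le_iff Max_gr_iff not_le)
    obtain y where y: "y < Min G" "X \<inter> {y<..<Min G} = {}" using gap_below[of "Min G"] by blast
    have "X \<inter> {\<beta><..Max G} = X \<inter> {Min G..Max G} - {..\<beta>}" using lo by auto
    then have GR: "X \<inter> {\<beta><..Max G} = G - {..\<beta>}" unfolding interval .
    have "{y<..\<beta>} = {y<..<Min G} \<union> {Min G..\<beta>}" using lo y(1) by auto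
    then have "X \<inter> {y<..\<beta>} = X \<inter> {Min G..\<beta>}" using y(2) by (simp add: Int_Un_distrib)
    also have "\<dots> = X \<inter> {Min G..Max G} \<inter> {..\<beta>}" using hi by auto
    also have "\<dots> = G \<inter> {..\<beta>}" unfolding interval ..
    finally have GL: "X \<inter> {y<..\<beta>} = G \<inter> {..\<beta>}" .
    have "mean t {\<beta><..Max G} \<le> mean t {y<..\<beta>}"
      by (rule mean_split_cluster[OF adm G _ GL GR ne]) auto
    moreover have "measure (mass_measure N x m) {\<beta><..Max G} > 0"
      unfolding measure_pos_iff using GR ne by simp
    ultimately show False using R lo hi y(1) by (metis leD less_le_trans)
  qed
qed

lemma mean_within_cluster:
  assumes adm: "admissible t \<xi>" and G: "G \<in> \<xi>" and y: "y \<in> {Min G<..Max G}"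
  shows "mean t {y..Max G} \<le> mean t {Min G..<y}"
proof -
  have "finite G" "G \<noteq> {}"
    using admissible_nonempty[OF adm G] finite_cluster[OF adm G] by auto
  then have "Min G \<in> G" "Max G \<in> G" by simp_all
  \<comment> \<open>The range of \<open>y\<close> puts \<open>Min G\<close> below the cut and
    \<open>Max G\<close> on or above it, so neither part is empty.\<close>
  then have "Min G \<in> G \<inter> {..<y}" "Max G \<in> G - {..<y}"
    using y by (simp_all only: Int_iff Diff_iff lessThan_iff greaterThanAtMost_iff not_less)
  then have ne: "G \<inter> {..<y} \<noteq> {}" "G - {..<y} \<noteq> {}" by blast+
  have "X \<inter> {Min G..<y} = X \<inter> {Min G..Max G} \<inter> {..<y}"
    "X \<inter> {y..Max G} = X \<inter> {Min G..Max G} - {..<y}"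
    using y by auto
  then have L: "X \<inter> {Min G..<y} = G \<inter> {..<y}" and R: "X \<inter> {y..Max G} = G - {..<y}"
    unfolding cluster_interval[OF adm G] .
  show ?thesis by (rule mean_split_cluster[OF adm G _ L R ne]) auto
qed

end


theorem theorem3p1:
  fixes N :: nat and x m :: "nat \<Rightarrow> real" and u0 \<gamma>0 :: "real \<Rightarrow> real" and t :: real
  assumes "strict_mono_on {1..N} x"
    and "\<forall>j\<in>{1..N}. 0 < m j"
    and "antimono_on (particles N x) \<gamma>0"
    and "0 < t"
  shows
    "(\<forall>G \<in> clusters N x m u0 \<gamma>0 t. \<forall>y \<in> {Min G <.. Max G}.
        mean_over (mass_measure N x m) (free_path u0 \<gamma>0 t) {Min G ..< y}
          \<ge> mean_over (mass_measure N x m) (free_path u0 \<gamma>0 t) {y .. Max G})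
   \<and> (\<forall>\<alpha> \<in> particles N x.
        (\<exists>G \<in> clusters N x m u0 \<gamma>0 t. \<alpha> = Min G) \<longleftrightarrow>
        (\<forall>y1 y2. y1 < \<alpha> \<and> \<alpha> < y2 \<and> measure (mass_measure N x m) {y1 ..< \<alpha>} > 0 \<longrightarrow>
           mean_over (mass_measure N x m) (free_path u0 \<gamma>0 t) {y1 ..< \<alpha>}
             < mean_over (mass_measure N x m) (free_path u0 \<gamma>0 t) {\<alpha> ..< y2}))
   \<and> (\<forall>\<beta> \<in> particles N x.
        (\<exists>G \<in> clusters N x m u0 \<gamma>0 t. \<beta> = Max G) \<longleftrightarrow>
        (\<forall>y1 y2. y1 < \<beta> \<and> \<beta> < y2 \<and> measure (mass_measure N x m) {\<beta> <.. y2} > 0 \<longrightarrow>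
           mean_over (mass_measure N x m) (free_path u0 \<gamma>0 t) {y1 <.. \<beta>}
             < mean_over (mass_measure N x m) (free_path u0 \<gamma>0 t) {\<beta> <.. y2}))"
proof -
  interpret particle_system N x m u0 \<gamma>0
    using assms by unfold_locales
  have adm: "admissible t (clusters N x m u0 \<gamma>0 t)"
    using assms by (intro admissible_clusters) simp
  show ?thesis
    using mean_within_cluster[OF adm] mean_left_endpoint[OF adm] mean_right_endpoint[OF adm] by blast
qed

end
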